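(* Let $n<k$ and let $\mathcal F=\{f_1,\dots,f_k\}$ be a binary $(k,n)$-frame. Then $\mathcal F$ has a complementary Parseval frame (Naimark complement) if and only if at least one of the frame vectors $f_1,\dots,f_k$ is even.
   Context: $\mathbb Z_2$ is the field with two elements and $\mathbb Z_2^n$ ($n\in\mathbb N=\{1,2,\dots\}$) carries the dot product $(x,y)=\sum_{i=1}^n x_iy_i\in\mathbb Z_2$. A binary $(k,n)$-frame (binary Parseval frame for $\mathbb Z_2^n$) is a sequence $\mathcal F=\{f_1,\dots,f_k\}$ of vectors in $\mathbb Z_2^n$ (repetitions allowed) such that $x=\sum_{j=1}^k (x,f_j)f_j$ for all $x\in\mathbb Z_2^n$. Its analysis matrix $\Theta_{\mathcal F}\in M_{k,n}(\mathbb Z_2)$ is the $k\times n$ matrix whose $i$th row is $f_i$. For a matrix $A$, $A^*$ denotes the transpose. A vector is even if it has an even number of non-zero entries (equivalently its entries sum to $0$ in $\mathbb Z_2$), and odd otherwise. A binary Parseval frame $\mathcal F$ with analysis matrix $\Theta_{\mathcal F}\in M_{k,n}(\mathbb Z_2)$ and a binary Parseval frame $\mathcal G$ with analysis matrix $\Theta_{\mathcal G}\in M_{k,k-n}(\mathbb Z_2)$ are complementary (Naimark complements of each other) if $\Theta_{\mathcal F}\Theta_{\mathcal F}^*+\Theta_{\mathcal G}\Theta_{\mathcal G}^*=I_k$. *)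

theory Defs
  imports "HOL-Library.Z2" "Jordan_Normal_Form.Matrix"
begin

text \<open>
  The field with two elements is the type \<^typ>\<open>bit\<close>, and its \<open>n\<close>-dimensional vector space is
  \<open>carrier_vec n\<close>. The frame vectors \<open>f\<^sub>1, \<dots>, f\<^sub>k\<close> are the entries \<open>fs ! 0, \<dots>, fs ! (k - 1)\<close>
  of a list.
\<close>

definition binary_frame :: "nat \<Rightarrow> nat \<Rightarrow> bit vec list \<Rightarrow> bool" where
  "binary_frame k n fs \<longleftrightarrow>
     length fs = k \<and> set fs \<subseteq> carrier_vec n \<and>
     (\<forall>x \<in> carrier_vec n.
        x = finsum_vec TYPE(bit) n (\<lambda>j. (x \<bullet> (fs ! j)) \<cdot>\<^sub>v (fs ! j)) {..<k})"

definition analysis_matrix :: "nat \<Rightarrow> bit vec list \<Rightarrow> bit mat" where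
  "analysis_matrix n fs = mat_of_rows n fs"

definition complementary_frames :: "nat \<Rightarrow> nat \<Rightarrow> bit vec list \<Rightarrow> bit vec list \<Rightarrow> bool" where
  "complementary_frames k n fs gs \<longleftrightarrow>
     binary_frame k n fs \<and> binary_frame k (k - n) gs \<and>
     analysis_matrix n fs * transpose_mat (analysis_matrix n fs) +
     analysis_matrix (k - n) gs * transpose_mat (analysis_matrix (k - n) gs) = 1\<^sub>m k"

definition even_vec :: "bit vec \<Rightarrow> bool" where
  "even_vec v \<longleftrightarrow> even (card {i. i < dim_vec v \<and> v $ i \<noteq> 0})"

end

theory Submission
  imports Defs "Jordan_Normal_Form.Determinant"
begin

text \<open>
  Write \<open>A\<close> for the \<open>k \<times> n\<close> analysis matrix of the frame \<open>f\<^sub>1, \<dots>, f\<^sub>k\<close>. The Parseval property says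
  exactly that the columns of \<open>A\<close> are orthonormal, that is \<open>A\<^sup>T A = I\<close>
  (\<open>binary_frame_iff_orthonormal\<close>). A Naimark complement is a matrix \<open>B\<close> whose orthonormal columns
  satisfy \<open>B B\<^sup>T = I - A A\<^sup>T\<close>, and an orthonormal basis of the whole space that begins with the columns
  of \<open>A\<close> provides one: its remaining columns form \<open>B\<close>, because a square matrix with orthonormal columns
  also has orthonormal rows. So the question is when the columns of \<open>A\<close> extend to an
  orthonormal basis.

  The obstruction comes from \<open>x\<^sup>2 = x\<close> in \<open>\<int>\<^sub>2\<close>: the \<open>j\<close>-th diagonal entry of \<open>A A\<^sup>T\<close> is the sum of the
  entries of \<open>f\<^sub>j\<close>. If all frame vectors are odd, then \<open>B B\<^sup>T\<close> has zero diagonal, so every row of \<open>B\<close>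
  sums to zero. Hence \<open>B\<close> annihilates the all-ones vector, which contradicts \<open>B\<^sup>T B = I\<close>.

  For the converse, let \<open>Q = I - A A\<^sup>T\<close> be the orthogonal projection onto the complement of the
  columns of \<open>A\<close>. A frame vector \<open>f\<^sub>j\<close> is even iff \<open>Q\<^sub>j\<^sub>j = 1\<close>, and then \<open>Q e\<^sub>j\<close> is a vector of norm one
  orthogonal to the columns of \<open>A\<close>. Adjoining a vector \<open>v\<close> changes the diagonal \<open>d\<close> of \<open>Q\<close> into
  \<open>d + v\<close>, so the process can be repeated as long as \<open>v \<noteq> d\<close>. Such a choice fails only if \<open>Q = d d\<^sup>T\<close>,
  in which case \<open>Q\<close> has rank one and just one column is missing (\<open>extend_orthonormal\<close>).
\<close>

text \<open>
  The library rewrites addition and multiplication of bits to exclusive or and conjunction, which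
  hides the field structure from the lemmas on finite sums.
\<close>

declare add_bit_eq_xor [simp del] mult_bit_eq_and [simp del]

lemma bit_add_self: "x + x = (0 :: bit)"
  by (cases x) simp_all

lemma bit_mult_self: "x * x = (x :: bit)"
  by (cases x) simp_all

lemma sum_mult_delta:
  fixes f :: "nat \<Rightarrow> 'a :: comm_semiring_1"
  assumes "j < k"
  shows "(\<Sum>i<k. f i * (if i = j then 1 else 0)) = f j"
proof -
  have "(\<Sum>i<k. f i * (if i = j then 1 else 0)) = (\<Sum>i<k. if i = j then f i else 0)"
    by (intro sum.cong) auto
  then show ?thesis using assms by simp
qed

lemma sum_lessThan_add:
  fixes f :: "nat \<Rightarrow> 'a :: comm_monoid_add"
  shows "(\<Sum>c<n + m. f c) = (\<Sum>c<n. f c) + (\<Sum>c<m. f (n + c))"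
  by (induction m) (simp_all add: add.assoc)

section \<open>Orthonormal families of coordinate vectors\<close>

text \<open>
  A family is a function \<open>u\<close> with \<open>u a i\<close> the \<open>i\<close>-th coordinate of the \<open>a\<close>-th vector. Neither the
  number of vectors nor that of coordinates is part of its type, so vectors can be appended freely, and
  \<open>\<lambda>i a. u a i\<close> is the transposed family.
\<close>

definition orthonormal :: "nat \<Rightarrow> nat \<Rightarrow> (nat \<Rightarrow> nat \<Rightarrow> 'a :: field) \<Rightarrow> bool" where
  "orthonormal k m u \<longleftrightarrow>
     (\<forall>a<m. \<forall>b<m. (\<Sum>i<k. u a i * u b i) = (if a = b then 1 else 0))"

lemma orthonormalD:
  assumes "orthonormal k m u" "a < m" "b < m"
  shows "(\<Sum>i<k. u a i * u b i) = (if a = b then 1 else 0)"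
  using assms by (simp add: orthonormal_def)

text \<open>This is the fact that a left inverse of a square matrix is also a right inverse.\<close>

lemma orthonormal_square_transpose:
  assumes "orthonormal k k u"
  shows "orthonormal k k (\<lambda>i a. u a i)"
proof -
  define M where "M = mat k k (\<lambda>(i, a). u a i)"
  have M: "M \<in> carrier_mat k k" "M\<^sup>T \<in> carrier_mat k k" by (simp_all add: M_def)
  have "M\<^sup>T * M = 1\<^sub>m k"
    by (rule eq_matI)
      (auto simp: M_def scalar_prod_def atLeast0LessThan orthonormalD[OF assms])
  then have MM: "M * M\<^sup>T = 1\<^sub>m k"
    using mat_mult_left_right_inverse[OF M(2) M(1)] by simp
  have "(\<Sum>a<k. u a i * u a j) = (if i = j then 1 else 0)" if "i < k" "j < k" for i j
    using arg_cong[OF MM, of "\<lambda>N. N $$ (i, j)"] that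
    by (auto simp: M_def scalar_prod_def atLeast0LessThan)
  then show ?thesis by (simp add: orthonormal_def)
qed

text \<open>
  A dimension bound: if \<open>m\<close> were smaller than \<open>k\<close>, padding the vectors with zeros would give a square
  matrix with orthonormal rows and a zero column.
\<close>

lemma orthonormal_card_le:
  assumes "orthonormal m k w"
  shows "k \<le> m"
proof (rule ccontr)
  assume "\<not> k \<le> m"
  then have "m < k" by simp
  define w' where "w' = (\<lambda>i a. if a < m then w i a else 0)"
  have "(\<Sum>a<k. w' i a * w' j a) = (\<Sum>a<m. w i a * w j a)" for i j
    using \<open>m < k\<close> by (intro sum.mono_neutral_cong_right) (auto simp: w'_def)
  then have "orthonormal k k w'"
    using assms by (simp add: orthonormal_def)
  from orthonormalD[OF orthonormal_square_transpose[OF this] \<open>m < k\<close> \<open>m < k\<close>]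
  show False by (simp add: w'_def)
qed

lemma orthonormal_snoc:
  assumes u: "orthonormal k m u"
    and orth: "\<And>a. a < m \<Longrightarrow> (\<Sum>i<k. u a i * v i) = 0"
    and norm: "(\<Sum>i<k. v i * v i) = 1"
  shows "orthonormal k (Suc m) (u(m := v))"
proof -
  have "(\<Sum>i<k. v i * u a i) = 0" if "a < m" for a
    using orth[OF that] by (simp add: mult.commute)
  then show ?thesis
    using orth norm orthonormalD[OF u] by (auto simp: orthonormal_def less_Suc_eq)
qed

section \<open>The projection onto the orthogonal complement\<close>

text \<open>
  For an orthonormal family of \<open>m\<close> vectors this is the matrix of the orthogonal projection
  \<open>I - A A\<^sup>T\<close>, where the vectors are the columns of \<open>A\<close>; the signs agree in characteristic two.
\<close>

definition complement_proj :: "nat \<Rightarrow> (nat \<Rightarrow> nat \<Rightarrow> bit) \<Rightarrow> nat \<Rightarrow> nat \<Rightarrow> bit" where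
  "complement_proj m u i j = (if i = j then 1 else 0) + (\<Sum>c<m. u c i * u c j)"

lemma complement_proj_sym: "complement_proj m u i j = complement_proj m u j i"
  by (simp add: complement_proj_def mult.commute eq_commute)

lemma complement_proj_diag: "complement_proj m u j j = 1 + (\<Sum>c<m. u c j)"
  by (simp add: complement_proj_def bit_mult_self)

lemma complement_proj_snoc_diag:
  "complement_proj (Suc m) (u(m := v)) j j = complement_proj m u j j + v j"
  by (simp add: complement_proj_diag add.assoc)

lemma complement_proj_orthogonal:
  assumes u: "orthonormal k m u" and "a < m" "j < k"
  shows "(\<Sum>i<k. u a i * complement_proj m u i j) = 0"
proof -
  have "(\<Sum>i<k. u a i * complement_proj m u i j)
      = (\<Sum>i<k. u a i * (if i = j then 1 else 0)) + (\<Sum>i<k. \<Sum>c<m. u c j * (u a i * u c i))"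
    by (simp add: complement_proj_def distrib_left sum.distrib sum_distrib_left mult_ac)
  also have "(\<Sum>i<k. u a i * (if i = j then 1 else 0)) = u a j"
    using \<open>j < k\<close> by (rule sum_mult_delta)
  also have "(\<Sum>i<k. \<Sum>c<m. u c j * (u a i * u c i)) = (\<Sum>c<m. u c j * (\<Sum>i<k. u a i * u c i))"
    by (subst sum.swap) (simp add: sum_distrib_left)
  also have "\<dots> = (\<Sum>c<m. u c j * (if a = c then 1 else 0))"
    using orthonormalD[OF u \<open>a < m\<close>] by (intro sum.cong) auto
  also have "\<dots> = u a j"
    using sum_mult_delta[OF \<open>a < m\<close>, of "\<lambda>c. u c j"] by (simp only: eq_commute[of a])
  finally show ?thesis by (simp add: bit_add_self)
qed

lemma complement_proj_idem:
  assumes u: "orthonormal k m u" and "j < k" "l < k"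
  shows "(\<Sum>i<k. complement_proj m u i j * complement_proj m u i l) = complement_proj m u j l"
proof -
  let ?Q = "complement_proj m u"
  have "(\<Sum>i<k. ?Q i j * ?Q i l)
      = (\<Sum>i<k. ?Q i l * (if i = j then 1 else 0)) + (\<Sum>i<k. \<Sum>c<m. u c j * (u c i * ?Q i l))"
    unfolding complement_proj_def[of m u _ j]
    by (simp only: distrib_left distrib_right sum.distrib sum_distrib_right sum_distrib_left mult_ac)
  also have "(\<Sum>i<k. ?Q i l * (if i = j then 1 else 0)) = ?Q j l"
    using \<open>j < k\<close> by (rule sum_mult_delta)
  also have "(\<Sum>i<k. \<Sum>c<m. u c j * (u c i * ?Q i l)) = (\<Sum>c<m. u c j * (\<Sum>i<k. u c i * ?Q i l))"
    by (subst sum.swap) (simp add: sum_distrib_left)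
  also have "\<dots> = 0"
    using complement_proj_orthogonal[OF u _ \<open>l < k\<close>] by simp
  finally show ?thesis by simp
qed

section \<open>Extension to an orthonormal basis\<close>

text \<open>
  With \<open>Q\<close> the projection and \<open>d\<close> its diagonal, \<open>Q e\<^sub>j\<close> is a vector of norm one whenever
  \<open>d\<^sub>j = 1\<close>, and so is \<open>Q (e\<^sub>j + e\<^sub>l)\<close> if moreover \<open>d\<^sub>l = 0\<close>. All these vectors equal \<open>d\<close> only
  if \<open>Q = d d\<^sup>T\<close>. But then the family together with \<open>d\<close> resolves the identity, so that
  \<open>k \<le> Suc m\<close>. Any other choice leaves a nonzero entry on the diagonal of the new projection.
\<close>

lemma extend_orthonormal:
  assumes u: "orthonormal k m u"
    and j: "j < k" "complement_proj m u j j = 1"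
  shows "\<exists>v. orthonormal k (Suc m) (u(m := v)) \<and>
    (Suc m < k \<longrightarrow> (\<exists>i<k. complement_proj (Suc m) (u(m := v)) i i = 1))"
proof -
  define Q where "Q = complement_proj m u"
  have sym: "Q i l = Q l i" for i l
    unfolding Q_def by (rule complement_proj_sym)
  have idem: "(\<Sum>i<k. Q i l * Q i l') = Q l l'" if "l < k" "l' < k" for l l'
    unfolding Q_def by (rule complement_proj_idem[OF u that])
  have orth: "(\<Sum>i<k. u a i * Q i l) = 0" if "a < m" "l < k" for a l
    unfolding Q_def by (rule complement_proj_orthogonal[OF u that])
  have single: "orthonormal k (Suc m) (u(m := (\<lambda>i. Q i l)))" if "l < k" "Q l l = 1" for l
    using that by (intro orthonormal_snoc[OF u]) (simp_all add: orth idem)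
  have pair: "orthonormal k (Suc m) (u(m := (\<lambda>i. Q i l + Q i l')))"
    if l: "l < k" "l' < k" "Q l l = 1" "Q l' l' = 0" for l l'
  proof (rule orthonormal_snoc[OF u])
    show "(\<Sum>i<k. u a i * (Q i l + Q i l')) = 0" if "a < m" for a
      using that l by (simp add: distrib_left sum.distrib orth)
    have "(\<Sum>i<k. (Q i l + Q i l') * (Q i l + Q i l')) = (Q l l + Q l' l) + (Q l l' + Q l' l')"
      by (simp only: distrib_left distrib_right sum.distrib idem l(1,2))
    also have "\<dots> = 1 + (Q l l' + Q l l')"
      by (simp only: l(3,4) sym[of l' l] add_0_right add.assoc)
    also have "\<dots> = 1"
      by (simp only: bit_add_self add_0_right)
    finally show "(\<Sum>i<k. (Q i l + Q i l') * (Q i l + Q i l')) = 1" .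
  qed
  \<comment> \<open>The new diagonal is \<open>d + v\<close>, so it is enough that \<open>v\<close> differs from \<open>d\<close> somewhere.\<close>
  have good: ?thesis
    if "orthonormal k (Suc m) (u(m := v))" "i < k" "v i \<noteq> Q i i" for v i
  proof -
    have "complement_proj (Suc m) (u(m := v)) i i = Q i i + v i"
      by (simp add: complement_proj_snoc_diag Q_def)
    also have "\<dots> = 1"
      using that(3) by (cases "v i"; cases "Q i i") simp_all
    finally show ?thesis using that(1,2) by blast
  qed
  show ?thesis
  proof (cases "\<forall>i<k. \<forall>l<k. Q i l = Q i i * Q l l")
    case True
    \<comment> \<open>The rank one case: the rows of \<open>u\<close> extended by \<open>d\<close> are orthonormal, which bounds \<open>k\<close>.\<close>
    let ?w = "\<lambda>i a. (u(m := (\<lambda>i. Q i i))) a i"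
    have "(\<Sum>a<Suc m. ?w i a * ?w l a) = (if i = l then 1 else 0)" if "i < k" "l < k" for i l
    proof -
      have "Q i i * Q l l = Q i l"
        using True[rule_format, OF that] by (rule HOL.sym)
      then have "(\<Sum>a<Suc m. ?w i a * ?w l a) = Q i l + (\<Sum>a<m. u a i * u a l)"
        by (simp add: add.commute)
      also have "\<dots> = (if i = l then 1 else 0)"
        by (simp only: Q_def complement_proj_def add.assoc bit_add_self add_0_right)
      finally show ?thesis .
    qed
    then have "orthonormal (Suc m) k ?w" by (simp only: orthonormal_def) blast
    then have "\<not> Suc m < k" using orthonormal_card_le by fastforce
    then show ?thesis using single[of j] j by (auto simp: Q_def)
  next
    case False
    \<comment> \<open>Depending on \<open>d\<^sub>l\<close> and \<open>Q\<^sub>i\<^sub>j\<close>, one of \<open>Q e\<^sub>l\<close>, \<open>Q (e\<^sub>j + e\<^sub>l)\<close>, \<open>Q e\<^sub>j\<close> differs from \<open>d\<close>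
      at the coordinate \<open>i\<close>.\<close>
    then obtain i l where il: "i < k" "l < k" "Q i l \<noteq> Q i i * Q l l" by blast
    show ?thesis
    proof (cases "Q l l = 1")
      case True
      then show ?thesis using good[OF single[of l]] il by auto
    next
      case False
      then have l0: "Q l l = 0" and il1: "Q i l = 1" using il by simp_all
      show ?thesis
      proof (cases "Q i j = Q i i")
        case True
        then show ?thesis
          using good[OF pair[of j l] \<open>i < k\<close>] il j l0 il1
          by (cases "Q i i") (simp_all add: Q_def)
      next
        case False
        then show ?thesis using good[OF single[of j] \<open>i < k\<close>] j by (simp add: Q_def)
      qed
    qed
  qed
qed

lemma extend_to_orthonormal_basis:
  assumes "orthonormal k m u" "m < k" "j < k" "complement_proj m u j j = 1"
  shows "\<exists>w. orthonormal k k w \<and> (\<forall>c<m. w c = u c)"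
  using assms
proof (induction "k - m" arbitrary: m u j)
  case 0
  then show ?case by simp
next
  case (Suc r)
  from extend_orthonormal[OF Suc.prems(1,3,4)] obtain v where
    v: "orthonormal k (Suc m) (u(m := v))"
       "Suc m < k \<longrightarrow> (\<exists>i<k. complement_proj (Suc m) (u(m := v)) i i = 1)" by blast
  show ?case
  proof (cases "Suc m < k")
    case True
    with v(2) obtain i where "i < k" "complement_proj (Suc m) (u(m := v)) i i = 1" by blast
    moreover have "r = k - Suc m" using Suc.hyps(2) by simp
    ultimately obtain w where "orthonormal k k w" "\<forall>c<Suc m. w c = (u(m := v)) c"
      using Suc.hyps(1)[OF _ v(1) True] by blast
    then show ?thesis by (intro exI[of _ w]) simp
  next
    case False
    then have "Suc m = k" using Suc.prems(2) by simp
    then show ?thesis using v(1) by (intro exI[of _ "u(m := v)"]) auto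
  qed
qed

section \<open>Binary Parseval frames\<close>

lemma even_vec_iff: "even_vec v \<longleftrightarrow> (\<Sum>i<dim_vec v. v $ i) = 0"
proof -
  let ?S = "{i. i < dim_vec v \<and> v $ i \<noteq> 0}"
  have "(\<Sum>i<dim_vec v. v $ i) = (\<Sum>i\<in>?S. 1)"
    by (intro sum.mono_neutral_cong_right) auto
  also have "\<dots> = of_nat (card ?S)" by simp
  also have "(of_nat (card ?S) :: bit) = 0 \<longleftrightarrow> even (card ?S)"
    by (cases "of_nat (card ?S) :: bit") (simp_all flip: even_of_nat[where 'a = bit])
  finally show ?thesis by (simp add: even_vec_def)
qed

text \<open>
  The reconstruction formula reads \<open>A\<^sup>T A x = x\<close>. By linearity it needs to be tested on unit vectors
  only, where its coordinates are the inner products of the columns of \<open>A\<close>.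
\<close>

lemma binary_frame_iff_orthonormal:
  assumes len: "length fs = k" and carrier: "set fs \<subseteq> carrier_vec n"
  shows "binary_frame k n fs \<longleftrightarrow> orthonormal k n (\<lambda>a i. fs ! i $ a)"
proof -
  have f: "fs ! j \<in> carrier_vec n" if "j < k" for j
    using that carrier len by (metis nth_mem subsetD)
  let ?s = "\<lambda>x. finsum_vec TYPE(bit) n (\<lambda>j. (x \<bullet> (fs ! j)) \<cdot>\<^sub>v (fs ! j)) {..<k}"
  have s_carrier: "?s x \<in> carrier_vec n" for x
    using f by (intro finsum_vec_closed) auto
  have s_coord: "?s x $ b = (\<Sum>j<k. (\<Sum>a<n. x $ a * fs ! j $ a) * fs ! j $ b)" if "b < n" for x b
  proof -
    have "?s x $ b = (\<Sum>j<k. ((x \<bullet> (fs ! j)) \<cdot>\<^sub>v (fs ! j)) $ b)"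
      using that f by (intro index_finsum_vec) auto
    also have "\<dots> = (\<Sum>j<k. (\<Sum>a<n. x $ a * fs ! j $ a) * fs ! j $ b)"
    proof (rule sum.cong[OF refl])
      fix j assume "j \<in> {..<k}"
      then have "dim_vec (fs ! j) = n" using f by auto
      then show "((x \<bullet> (fs ! j)) \<cdot>\<^sub>v (fs ! j)) $ b = (\<Sum>a<n. x $ a * fs ! j $ a) * fs ! j $ b"
        using that by (simp add: scalar_prod_def atLeast0LessThan)
    qed
    finally show ?thesis .
  qed
  show ?thesis
  proof
    assume frame: "binary_frame k n fs"
    have "(\<Sum>i<k. fs ! i $ a * fs ! i $ b) = (if a = b then 1 else 0)" if "a < n" "b < n" for a b
    proof -
      have "(\<Sum>c<n. (unit_vec n a :: bit vec) $ c * fs ! j $ c) = fs ! j $ a" for j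
      proof -
        have "(\<Sum>c<n. (unit_vec n a :: bit vec) $ c * fs ! j $ c)
            = (\<Sum>c<n. if c = a then fs ! j $ c else 0)"
          using that by (intro sum.cong) (auto simp: unit_vec_def)
        then show ?thesis using that by simp
      qed
      then have "?s (unit_vec n a) $ b = (\<Sum>i<k. fs ! i $ a * fs ! i $ b)"
        using s_coord[OF that(2), of "unit_vec n a"] by simp
      moreover have "?s (unit_vec n a) = unit_vec n a"
        using frame unfolding binary_frame_def by (metis unit_vec_carrier)
      ultimately show ?thesis using that by (simp add: unit_vec_def eq_commute)
    qed
    then show "orthonormal k n (\<lambda>a i. fs ! i $ a)" by (simp add: orthonormal_def)
  next
    assume on: "orthonormal k n (\<lambda>a i. fs ! i $ a)"
    have "x = ?s x" if x: "x \<in> carrier_vec n" for x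
    proof (rule eq_vecI)
      show "dim_vec x = dim_vec (?s x)" using x s_carrier[of x] by (metis carrier_vecD)
      fix b assume "b < dim_vec (?s x)"
      then have b: "b < n" using s_carrier[of x] by (metis carrier_vecD)
      have "?s x $ b = (\<Sum>j<k. \<Sum>a<n. x $ a * (fs ! j $ a * fs ! j $ b))"
        by (simp add: s_coord[OF b] sum_distrib_right mult.assoc)
      also have "\<dots> = (\<Sum>a<n. x $ a * (\<Sum>j<k. fs ! j $ a * fs ! j $ b))"
        by (subst sum.swap) (simp add: sum_distrib_left)
      also have "\<dots> = (\<Sum>a<n. x $ a * (if a = b then 1 else 0))"
        using orthonormalD[OF on _ b] by (intro sum.cong) simp_all
      also have "\<dots> = x $ b" using b by (rule sum_mult_delta)
      finally show "x $ b = ?s x $ b" by simp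
    qed
    then show "binary_frame k n fs" using len carrier by (simp add: binary_frame_def)
  qed
qed

lemma binary_frame_dim_vec:
  assumes "binary_frame k n fs" "j < k"
  shows "dim_vec (fs ! j) = n"
  using assms unfolding binary_frame_def by (metis carrier_vecD nth_mem subsetD)

lemma complementary_frames_iff:
  assumes "binary_frame k n fs"
  shows "complementary_frames k n fs gs \<longleftrightarrow> binary_frame k (k - n) gs \<and>
    (\<forall>i<k. \<forall>j<k. (\<Sum>a<n. fs ! i $ a * fs ! j $ a) + (\<Sum>c<k - n. gs ! i $ c * gs ! j $ c)
       = (if i = j then 1 else 0))"
proof (cases "binary_frame k (k - n) gs")
  case True
  then have len: "length fs = k" "length gs = k"
    and dim: "\<And>i. i < k \<Longrightarrow> dim_vec (fs ! i) = n" "\<And>i. i < k \<Longrightarrow> dim_vec (gs ! i) = k - n"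
    using binary_frame_dim_vec[OF assms] binary_frame_dim_vec[OF True] assms
    by (simp_all only: binary_frame_def)
  show ?thesis
    using True assms len dim
    by (auto simp: complementary_frames_def analysis_matrix_def mat_eq_iff scalar_prod_def
        atLeast0LessThan mat_of_rows_index)
next
  case False
  then show ?thesis by (simp add: complementary_frames_def)
qed

theorem theorem3p4:
  fixes k n :: nat and fs :: "bit vec list"
  assumes "1 \<le> n" and "n < k" and "binary_frame k n fs"
  shows "(\<exists>gs. complementary_frames k n fs gs) \<longleftrightarrow> (\<exists>j<k. even_vec (fs ! j))"
proof -
  note frame = \<open>binary_frame k n fs\<close>
  have len: "length fs = k" and carrier: "set fs \<subseteq> carrier_vec n"
    using frame by (simp_all add: binary_frame_def)
  define u where "u = (\<lambda>a i. fs ! i $ a)"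
  have u: "orthonormal k n u"
    using frame unfolding u_def binary_frame_iff_orthonormal[OF len carrier] .
  have even: "even_vec (fs ! j) \<longleftrightarrow> (\<Sum>a<n. fs ! j $ a) = 0" if "j < k" for j
    using binary_frame_dim_vec[OF frame that] by (simp add: even_vec_iff)
  show ?thesis
  proof
    assume "\<exists>gs. complementary_frames k n fs gs"
    then obtain gs where "complementary_frames k n fs gs" ..
    then have gs: "binary_frame k (k - n) gs"
      and gram: "\<And>j. j < k \<Longrightarrow>
        (\<Sum>a<n. fs ! j $ a * fs ! j $ a) + (\<Sum>c<k - n. gs ! j $ c * gs ! j $ c) = 1"
      using complementary_frames_iff[OF frame] by simp_all
    have g: "orthonormal k (k - n) (\<lambda>c i. gs ! i $ c)"
      using gs binary_frame_iff_orthonormal unfolding binary_frame_def by blast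
    show "\<exists>j<k. even_vec (fs ! j)"
    proof (rule ccontr)
      assume "\<not> (\<exists>j<k. even_vec (fs ! j))"
      then have "(\<Sum>a<n. fs ! j $ a) = 1" if "j < k" for j
        using even that by auto
      then have row: "(\<Sum>c<k - n. gs ! j $ c) = 0" if "j < k" for j
        using gram[OF that] that
        by (cases "\<Sum>c<k - n. gs ! j $ c") (simp_all add: bit_mult_self)
      \<comment> \<open>Evaluate the first coordinate of \<open>B\<^sup>T B 1\<close> in two ways, where \<open>B\<close> has the rows \<open>gs\<close> and
        \<open>1\<close> is the all-ones vector.\<close>
      have "(\<Sum>c<k - n. \<Sum>j<k. gs ! j $ 0 * gs ! j $ c) = (\<Sum>j<k. gs ! j $ 0 * (\<Sum>c<k - n. gs ! j $ c))"
        by (subst sum.swap) (simp add: sum_distrib_left)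
      also have "\<dots> = 0" using row by simp
      finally have "(\<Sum>c<k - n. \<Sum>j<k. gs ! j $ 0 * gs ! j $ c) = 0" .
      moreover have "(\<Sum>c<k - n. \<Sum>j<k. gs ! j $ 0 * gs ! j $ c)
          = (\<Sum>c<k - n. if 0 = c then 1 else 0)"
        using orthonormalD[OF g, of 0] \<open>n < k\<close> by (intro sum.cong) simp_all
      ultimately show False using \<open>n < k\<close> by simp
    qed
  next
    assume "\<exists>j<k. even_vec (fs ! j)"
    then obtain j where j: "j < k" "even_vec (fs ! j)" by blast
    then have "complement_proj n u j j = 1"
      using even by (simp add: complement_proj_diag u_def)
    from extend_to_orthonormal_basis[OF u \<open>n < k\<close> j(1) this] obtain w where
      w: "orthonormal k k w" and wu: "\<And>c. c < n \<Longrightarrow> w c = u c" by blast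
    define gs where "gs = map (\<lambda>i. vec (k - n) (\<lambda>c. w (n + c) i)) [0..<k]"
    have gs_len: "length gs = k" and gs_carrier: "set gs \<subseteq> carrier_vec (k - n)"
      by (auto simp: gs_def)
    have gs_nth: "gs ! i $ c = w (n + c) i" if "i < k" "c < k - n" for i c
      using that by (simp add: gs_def)
    have "orthonormal k (k - n) (\<lambda>c i. gs ! i $ c)"
      using orthonormalD[OF w] by (simp add: orthonormal_def gs_nth)
    then have "binary_frame k (k - n) gs"
      using binary_frame_iff_orthonormal[OF gs_len gs_carrier] by simp
    moreover have "(\<Sum>a<n. fs ! i $ a * fs ! l $ a) + (\<Sum>c<k - n. gs ! i $ c * gs ! l $ c)
        = (if i = l then 1 else 0)" if "i < k" "l < k" for i l
    proof -
      have "(\<Sum>a<n. fs ! i $ a * fs ! l $ a) + (\<Sum>c<k - n. gs ! i $ c * gs ! l $ c)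
          = (\<Sum>c<n. w c i * w c l) + (\<Sum>c<k - n. w (n + c) i * w (n + c) l)"
        using that by (simp add: wu u_def gs_nth)
      also have "\<dots> = (\<Sum>c<n + (k - n). w c i * w c l)"
        by (rule sum_lessThan_add[symmetric])
      also have "\<dots> = (if i = l then 1 else 0)"
        using orthonormalD[OF orthonormal_square_transpose[OF w] that] \<open>n < k\<close> by simp
      finally show ?thesis .
    qed
    ultimately show "\<exists>gs. complementary_frames k n fs gs"
      using complementary_frames_iff[OF frame] by blast
  qed
qed

end
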